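(* Let $G$ be a directed graph, and let $\widehat{G}$ be the graph obtained by adding a head at each source of $G$. For each category $\mathsf{C}$ there is an equivalence of categories $$\mathsf{Diag}^{\sqcup}_{\mathsf{C}}(G)\cong \mathsf{Diag}^{\sqcup}_{\mathsf{C}}(\widehat{G}).$$
   Context: A directed graph $G=(G^0,G^1,\mathrm{s},\mathrm{t})$ consists of a nonempty set $G^0$ of vertices, a set $G^1$ of edges, and source and target maps $\mathrm{s},\mathrm{t}:G^1\to G^0$ (no finiteness is assumed). A vertex $v$ is a source if $\mathrm{t}^{-1}(v)=\emptyset$. Let $G^0_0$ be the set of sources of $G$. The graph $\widehat{G}=(\widehat{G}^0,\widehat{G}^1,\hat{\mathrm{s}},\hat{\mathrm{t}})$ obtained by adding a head at each source is defined by $\widehat{G}^0=G^0\sqcup\{(v,n)\mid v\in G^0_0,\ n=1,2,3,\dots\}$, $\widehat{G}^1=G^1\sqcup\{e_{v,n}\mid v\in G^0_0,\ n=1,2,3,\dots\}$, $\hat{\mathrm{s}}(e)=\mathrm{s}(e)$ and $\hat{\mathrm{t}}(e)=\mathrm{t}(e)$ for $e\in G^1$, $\hat{\mathrm{s}}(e_{v,n})=(v,n)$, and $\hat{\mathrm{t}}(e_{v,n})=(v,n-1)$ if $n\ge2$, $\hat{\mathrm{t}}(e_{v,1})=v$. For a category $\mathsf{C}$, a diagram $D$ in $\mathsf{C}$ of shape $G$ consists of an object $D_v$ of $\mathsf{C}$ for each $v\in G^0$ and a morphism $D_e:D_{\mathrm{s}(e)}\to D_{\mathrm{t}(e)}$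 for each $e\in G^1$. A morphism $T:D\to E$ consists of morphisms $T_v:D_v\to E_v$ ($v\in G^0$) with $T_{\mathrm{t}(e)}\circ D_e=E_e\circ T_{\mathrm{s}(e)}$ for all $e\in G^1$. The diagram $D$ satisfies the coproduct condition if for every vertex $v$ that is not a source, the family of morphisms $(D_e:D_{\mathrm{s}(e)}\to D_v\mid e\in \mathrm{t}^{-1}(v))$ makes $D_v$ a coproduct in $\mathsf{C}$ of the family $(D_{\mathrm{s}(e)}\mid e\in \mathrm{t}^{-1}(v))$ (this includes the requirement that such a coproduct exists). $\mathsf{Diag}^{\sqcup}_{\mathsf{C}}(G)$ is the category of diagrams in $\mathsf{C}$ of shape $G$ satisfying the coproduct condition, with all morphisms of diagrams between them. *)

theory Defs
  imports "HOL-Library.FuncSet" "Graph_Theory.Digraph"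
begin

section \<open>Directed graphs and heads\<close>

text \<open>
  Directed graphs are \<^typ>\<open>('v, 'e) pre_digraph\<close> satisfying \<^locale>\<open>wf_digraph\<close>, which imposes no
  finiteness; \<^const>\<open>tail\<close> is the source map, \<^const>\<open>head\<close> the target map, and
  \<^term>\<open>in_arcs G v\<close> the preimage of \<open>v\<close> under the target map.
\<close>

definition source_verts :: "('v, 'e) pre_digraph \<Rightarrow> 'v set" where
  "source_verts G = {v \<in> verts G. in_arcs G v = {}}"

text \<open>
  \<open>Inl\<close> embeds the given graph; \<open>Inr (v, n)\<close>, for a source \<open>v\<close> and \<open>n \<ge> 1\<close>, is the new vertex
  \<open>(v, n)\<close>, respectively the new edge \<open>e\<^sub>v\<^sub>,\<^sub>n\<close>.
\<close>
definition add_heads ::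
    "('v, 'e) pre_digraph \<Rightarrow> ('v + 'v \<times> nat, 'e + 'v \<times> nat) pre_digraph" where
  "add_heads G = \<lparr>
     verts = Inl ` verts G \<union> Inr ` (source_verts G \<times> {1..}),
     arcs = Inl ` arcs G \<union> Inr ` (source_verts G \<times> {1..}),
     tail = (\<lambda>x. case x of Inl e \<Rightarrow> Inl (tail G e) | Inr (v, n) \<Rightarrow> Inr (v, n)),
     head = (\<lambda>x. case x of Inl e \<Rightarrow> Inl (head G e)
                         | Inr (v, n) \<Rightarrow> if n \<ge> 2 then Inr (v, n - 1) else Inl v) \<rparr>"

lemma wf_digraph_add_heads:
  assumes "wf_digraph G"
  shows "wf_digraph (add_heads G)"
proof -
  interpret wf_digraph G by fact
  show ?thesis
    by unfold_locales (auto simp: add_heads_def source_verts_def split: if_splits)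
qed


section \<open>Categories\<close>

text \<open>
  Objects and arrows are carried by sets; the operations are only constrained on the carriers,
  and \<open>Comp\<close> only on composable pairs.
\<close>
record ('o, 'm) pre_category =
  Obj :: "'o set"
  Arr :: "'m set"
  Dom :: "'m \<Rightarrow> 'o"
  Cod :: "'m \<Rightarrow> 'o"
  Ide :: "'o \<Rightarrow> 'm"
  Comp :: "'m \<Rightarrow> 'm \<Rightarrow> 'm"  (infixr \<open>\<cdot>\<index>\<close> 70)

definition Hom :: "('o, 'm) pre_category \<Rightarrow> 'o \<Rightarrow> 'o \<Rightarrow> 'm set" where
  "Hom C a b = {f \<in> Arr C. Dom C f = a \<and> Cod C f = b}"

locale category =
  fixes C :: "('o, 'm) pre_category" (structure)
  assumes Dom_Obj: "f \<in> Arr C \<Longrightarrow> Dom C f \<in> Obj C"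
    and Cod_Obj: "f \<in> Arr C \<Longrightarrow> Cod C f \<in> Obj C"
    and Ide_Hom: "a \<in> Obj C \<Longrightarrow> Ide C a \<in> Hom C a a"
    and Comp_Hom: "\<lbrakk>f \<in> Hom C a b; g \<in> Hom C b c\<rbrakk> \<Longrightarrow> g \<cdot> f \<in> Hom C a c"
    and Comp_Ide_right: "f \<in> Hom C a b \<Longrightarrow> f \<cdot> Ide C a = f"
    and Comp_Ide_left: "f \<in> Hom C a b \<Longrightarrow> Ide C b \<cdot> f = f"
    and Comp_assoc:
      "\<lbrakk>f \<in> Hom C a b; g \<in> Hom C b c; h \<in> Hom C c d\<rbrakk> \<Longrightarrow> (h \<cdot> g) \<cdot> f = h \<cdot> (g \<cdot> f)"

definition isomorphism :: "('o, 'm) pre_category \<Rightarrow> 'm \<Rightarrow> bool" where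
  "isomorphism C f \<longleftrightarrow>
     (\<exists>a b g. f \<in> Hom C a b \<and> g \<in> Hom C b a \<and>
        g \<cdot>\<^bsub>C\<^esub> f = Ide C a \<and> f \<cdot>\<^bsub>C\<^esub> g = Ide C b)"

locale cat_functor =
  dom: category A + cod: category B
  for A :: "('o1, 'm1) pre_category" and B :: "('o2, 'm2) pre_category" +
  fixes Fo :: "'o1 \<Rightarrow> 'o2" and Fm :: "'m1 \<Rightarrow> 'm2"
  assumes Fo_Obj: "a \<in> Obj A \<Longrightarrow> Fo a \<in> Obj B"
    and Fm_Hom: "f \<in> Hom A a b \<Longrightarrow> Fm f \<in> Hom B (Fo a) (Fo b)"
    and Fm_Ide: "a \<in> Obj A \<Longrightarrow> Fm (Ide A a) = Ide B (Fo a)"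
    and Fm_Comp: "\<lbrakk>f \<in> Hom A a b; g \<in> Hom A b c\<rbrakk> \<Longrightarrow> Fm (g \<cdot>\<^bsub>A\<^esub> f) = Fm g \<cdot>\<^bsub>B\<^esub> Fm f"

locale nat_isomorphism =
  F: cat_functor A B Fo Fm + G: cat_functor A B Go Gm
  for A :: "('o1, 'm1) pre_category" and B :: "('o2, 'm2) pre_category"
    and Fo Fm Go Gm +
  fixes \<tau> :: "'o1 \<Rightarrow> 'm2"
  assumes component_Hom: "a \<in> Obj A \<Longrightarrow> \<tau> a \<in> Hom B (Fo a) (Go a)"
    and natural: "f \<in> Hom A a b \<Longrightarrow> \<tau> b \<cdot>\<^bsub>B\<^esub> Fm f = Gm f \<cdot>\<^bsub>B\<^esub> \<tau> a"
    and component_iso: "a \<in> Obj A \<Longrightarrow> isomorphism B (\<tau> a)"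

definition equivalent_categories ::
    "('o1, 'm1) pre_category \<Rightarrow> ('o2, 'm2) pre_category \<Rightarrow> bool" where
  "equivalent_categories A B \<longleftrightarrow>
     (\<exists>Fo Fm Go Gm \<eta> \<epsilon>.
        cat_functor A B Fo Fm \<and> cat_functor B A Go Gm \<and>
        nat_isomorphism A A id id (Go \<circ> Fo) (Gm \<circ> Fm) \<eta> \<and>
        nat_isomorphism B B (Fo \<circ> Go) (Fm \<circ> Gm) id id \<epsilon>)"

text \<open>
  The morphisms \<open>\<iota> i : X i \<rightarrow> q\<close>, \<open>i \<in> I\<close>, make \<open>q\<close> a coproduct of the family \<open>X\<close>. The index set is
  arbitrary; values of \<open>X\<close>, \<open>\<iota>\<close> and \<open>g\<close> outside \<open>I\<close> are irrelevant.
\<close>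
definition is_coproduct ::
    "('o, 'm) pre_category \<Rightarrow> 'i set \<Rightarrow> ('i \<Rightarrow> 'o) \<Rightarrow> 'o \<Rightarrow> ('i \<Rightarrow> 'm) \<Rightarrow> bool" where
  "is_coproduct C I X q \<iota> \<longleftrightarrow>
     q \<in> Obj C \<and> (\<forall>i\<in>I. X i \<in> Obj C) \<and> (\<forall>i\<in>I. \<iota> i \<in> Hom C (X i) q) \<and>
     (\<forall>z\<in>Obj C. \<forall>g. (\<forall>i\<in>I. g i \<in> Hom C (X i) z) \<longrightarrow>
        (\<exists>!h. h \<in> Hom C q z \<and> (\<forall>i\<in>I. h \<cdot>\<^bsub>C\<^esub> \<iota> i = g i)))"


section \<open>Diagrams\<close>

record ('v, 'e, 'o, 'm) diagram =
  vert_obj :: "'v \<Rightarrow> 'o"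
  arc_mor :: "'e \<Rightarrow> 'm"

text \<open>
  The families are extensional, i.e. take the value \<^const>\<open>undefined\<close> off the graph, so that
  equality of diagrams is equality of the families on \<^term>\<open>verts G\<close> and \<^term>\<open>arcs G\<close>.
\<close>
definition is_diagram ::
    "('o, 'm) pre_category \<Rightarrow> ('v, 'e) pre_digraph \<Rightarrow> ('v, 'e, 'o, 'm) diagram \<Rightarrow> bool" where
  "is_diagram C G D \<longleftrightarrow>
     vert_obj D \<in> verts G \<rightarrow>\<^sub>E Obj C \<and>
     arc_mor D \<in> (\<Pi>\<^sub>E e \<in> arcs G. Hom C (vert_obj D (tail G e)) (vert_obj D (head G e)))"

definition is_diagram_mor ::
    "('o, 'm) pre_category \<Rightarrow> ('v, 'e) pre_digraph \<Rightarrow>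
     ('v, 'e, 'o, 'm) diagram \<Rightarrow> ('v, 'e, 'o, 'm) diagram \<Rightarrow> ('v \<Rightarrow> 'm) \<Rightarrow> bool" where
  "is_diagram_mor C G D E T \<longleftrightarrow>
     T \<in> (\<Pi>\<^sub>E v \<in> verts G. Hom C (vert_obj D v) (vert_obj E v)) \<and>
     (\<forall>e\<in>arcs G. T (head G e) \<cdot>\<^bsub>C\<^esub> arc_mor D e = arc_mor E e \<cdot>\<^bsub>C\<^esub> T (tail G e))"

definition coproduct_condition ::
    "('o, 'm) pre_category \<Rightarrow> ('v, 'e) pre_digraph \<Rightarrow> ('v, 'e, 'o, 'm) diagram \<Rightarrow> bool" where
  "coproduct_condition C G D \<longleftrightarrow>
     (\<forall>v \<in> verts G - source_verts G.
        is_coproduct C (in_arcs G v) (\<lambda>e. vert_obj D (tail G e)) (vert_obj D v) (arc_mor D))"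

text \<open>
  An arrow of the category of diagrams carries its domain and codomain along with the family of
  components, since the latter does not determine the former two.
\<close>
record ('v, 'e, 'o, 'm) diagram_arrow =
  arrow_dom :: "('v, 'e, 'o, 'm) diagram"
  arrow_cod :: "('v, 'e, 'o, 'm) diagram"
  component :: "'v \<Rightarrow> 'm"

definition Diag ::
    "('o, 'm) pre_category \<Rightarrow> ('v, 'e) pre_digraph \<Rightarrow>
     (('v, 'e, 'o, 'm) diagram, ('v, 'e, 'o, 'm) diagram_arrow) pre_category" where
  "Diag C G = (let Ob = {D. is_diagram C G D \<and> coproduct_condition C G D} in \<lparr>
     Obj = Ob,
     Arr = {t. arrow_dom t \<in> Ob \<and> arrow_cod t \<in> Ob \<and>
               is_diagram_mor C G (arrow_dom t) (arrow_cod t) (component t)},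
     Dom = arrow_dom,
     Cod = arrow_cod,
     Ide = (\<lambda>D. \<lparr>arrow_dom = D, arrow_cod = D,
                 component = (\<lambda>v\<in>verts G. Ide C (vert_obj D v))\<rparr>),
     Comp = (\<lambda>s t. \<lparr>arrow_dom = arrow_dom t, arrow_cod = arrow_cod s,
                    component = (\<lambda>v\<in>verts G. component s v \<cdot>\<^bsub>C\<^esub> component t v)\<rparr>) \<rparr>)"

lemma category_Diag:
  assumes "wf_digraph G" and "category C"
  shows "category (Diag C G)"
proof -
  interpret wf_digraph G by fact
  interpret category C by fact
  have id_mor: "is_diagram_mor C G D D (\<lambda>v\<in>verts G. Ide C (vert_obj D v))"
    if "is_diagram C G D" for D
  proof -
    have "Ide C (vert_obj D (head G e)) \<cdot>\<^bsub>C\<^esub> arc_mor D e = arc_mor D e \<cdot>\<^bsub>C\<^esub> Ide C (vert_obj D (tail G e))"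
      if "e \<in> arcs G" for e
    proof -
      have "arc_mor D e \<in> Hom C (vert_obj D (tail G e)) (vert_obj D (head G e))"
        using \<open>is_diagram C G D\<close> that by (auto simp: is_diagram_def)
      then show ?thesis
        by (simp add: Comp_Ide_left Comp_Ide_right)
    qed
    then show ?thesis
      using that by (auto simp: is_diagram_def is_diagram_mor_def intro!: Ide_Hom)
  qed
  have comp_mor: "is_diagram_mor C G D F (\<lambda>v\<in>verts G. S v \<cdot>\<^bsub>C\<^esub> T v)"
    if "is_diagram C G D" "is_diagram C G E" "is_diagram C G F"
      and T: "is_diagram_mor C G D E T" and S: "is_diagram_mor C G E F S" for D E F S T
  proof -
    have Hom_T: "T v \<in> Hom C (vert_obj D v) (vert_obj E v)"
      and Hom_S: "S v \<in> Hom C (vert_obj E v) (vert_obj F v)" if "v \<in> verts G" for v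
      using T S that by (auto simp: is_diagram_mor_def)
    have "(S (head G e) \<cdot>\<^bsub>C\<^esub> T (head G e)) \<cdot>\<^bsub>C\<^esub> arc_mor D e = arc_mor F e \<cdot>\<^bsub>C\<^esub> S (tail G e) \<cdot>\<^bsub>C\<^esub> T (tail G e)"
      if e: "e \<in> arcs G" for e
    proof -
      have D: "arc_mor D e \<in> Hom C (vert_obj D (tail G e)) (vert_obj D (head G e))"
        and E: "arc_mor E e \<in> Hom C (vert_obj E (tail G e)) (vert_obj E (head G e))"
        and F: "arc_mor F e \<in> Hom C (vert_obj F (tail G e)) (vert_obj F (head G e))"
        using \<open>is_diagram C G D\<close> \<open>is_diagram C G E\<close> \<open>is_diagram C G F\<close> e
        by (auto simp: is_diagram_def)
      note h = Hom_T[OF head_in_verts[OF e]] Hom_S[OF head_in_verts[OF e]]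
      note t = Hom_T[OF tail_in_verts[OF e]] Hom_S[OF tail_in_verts[OF e]]
      have "(S (head G e) \<cdot>\<^bsub>C\<^esub> T (head G e)) \<cdot>\<^bsub>C\<^esub> arc_mor D e
          = S (head G e) \<cdot>\<^bsub>C\<^esub> arc_mor E e \<cdot>\<^bsub>C\<^esub> T (tail G e)"
        using T e by (simp add: Comp_assoc[OF D h] is_diagram_mor_def)
      also have "\<dots> = (arc_mor F e \<cdot>\<^bsub>C\<^esub> S (tail G e)) \<cdot>\<^bsub>C\<^esub> T (tail G e)"
        using S e by (simp add: Comp_assoc[OF t(1) E h(2), symmetric] is_diagram_mor_def)
      also have "\<dots> = arc_mor F e \<cdot>\<^bsub>C\<^esub> S (tail G e) \<cdot>\<^bsub>C\<^esub> T (tail G e)"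
        by (rule Comp_assoc[OF t F])
      finally show ?thesis .
    qed
    then show ?thesis
      using Hom_S Hom_T by (auto simp: is_diagram_mor_def intro: Comp_Hom)
  qed
  show ?thesis
  proof
    fix D assume "D \<in> Obj (Diag C G)"
    then show "Ide (Diag C G) D \<in> Hom (Diag C G) D D"
      using id_mor by (auto simp: Diag_def Let_def Hom_def)
  next
    fix D E F s t assume "t \<in> Hom (Diag C G) D E" "s \<in> Hom (Diag C G) E F"
    then show "s \<cdot>\<^bsub>Diag C G\<^esub> t \<in> Hom (Diag C G) D F"
      using comp_mor by (auto simp: Diag_def Let_def Hom_def)
  next
    fix D E t assume t: "t \<in> Hom (Diag C G) D E"
    then have T: "component t \<in> (\<Pi>\<^sub>E v \<in> verts G. Hom C (vert_obj D v) (vert_obj E v))"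
      by (auto simp: Diag_def Let_def Hom_def is_diagram_mor_def)
    then have "(\<lambda>v\<in>verts G. component t v \<cdot>\<^bsub>C\<^esub> Ide C (vert_obj D v)) = component t"
      "(\<lambda>v\<in>verts G. Ide C (vert_obj E v) \<cdot>\<^bsub>C\<^esub> component t v) = component t"
      by (auto simp: fun_eq_iff restrict_def PiE_iff extensional_def Comp_Ide_left Comp_Ide_right)
    with t show "t \<cdot>\<^bsub>Diag C G\<^esub> Ide (Diag C G) D = t" "Ide (Diag C G) E \<cdot>\<^bsub>Diag C G\<^esub> t = t"
      by (auto simp: Diag_def Let_def Hom_def cong: restrict_cong)
  next
    fix D E F H r s t
    assume "t \<in> Hom (Diag C G) D E" "s \<in> Hom (Diag C G) E F" "r \<in> Hom (Diag C G) F H"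
    then have "component t v \<in> Hom C (vert_obj D v) (vert_obj E v)"
      "component s v \<in> Hom C (vert_obj E v) (vert_obj F v)"
      "component r v \<in> Hom C (vert_obj F v) (vert_obj H v)" if "v \<in> verts G" for v
      using that by (auto simp: Diag_def Let_def Hom_def is_diagram_mor_def)
    then show "(r \<cdot>\<^bsub>Diag C G\<^esub> s) \<cdot>\<^bsub>Diag C G\<^esub> t = r \<cdot>\<^bsub>Diag C G\<^esub> s \<cdot>\<^bsub>Diag C G\<^esub> t"
      by (auto simp: Diag_def Let_def fun_eq_iff restrict_def intro: Comp_assoc)
  qed (auto simp: Diag_def Let_def)
qed

end

theory Submission
  imports Defs
begin

text \<open>
  Along the head added at a source \<open>v\<close>, every vertex has exactly one incoming edge, so there the
  coproduct condition speaks of coproducts of one-element families: it says that all the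
  morphisms \<open>\<dots> \<rightarrow> D\<^sub>(\<^sub>v\<^sub>,\<^sub>2\<^sub>) \<rightarrow> D\<^sub>(\<^sub>v\<^sub>,\<^sub>1\<^sub>) \<rightarrow> D\<^sub>v\<close> are isomorphisms
  (\<open>is_coproduct_singleton_iff\<close>, \<open>coproduct_condition_add_heads_iff\<close>). The heads therefore carry no
  information beyond the object \<open>D\<^sub>v\<close>, and the equivalence is restriction of diagrams from the
  larger graph to \<open>G\<close>.

  Restriction is fully faithful. A morphism \<open>T\<close> between restricted diagrams extends along each
  head one vertex at a time: naturality at the edge from \<open>(v, n + 1)\<close> to its predecessor demands
  that the composite of the new component with an isomorphism be a given morphism, which
  determines the component (\<open>ex1_extension_of_diagram_mor\<close>). Restriction is also
  surjective on objects, not only up to isomorphism: a diagram of shape \<open>G\<close> extends by constant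
  heads, that is, by copies of \<open>D\<^sub>v\<close> and identities. A fully faithful functor that is surjective
  on objects is an equivalence (\<open>equivalent_categories_if_fully_faithful_surjective\<close>), and this
  general fact produces the inverse functor and both natural isomorphisms, so that none of them
  has to be described on the heads.
\<close>

section \<open>Equivalences from fully faithful functors\<close>

lemma cat_functor_comp:
  assumes "cat_functor A B Fo Fm" and "cat_functor B D Go Gm"
  shows "cat_functor A D (Go \<circ> Fo) (Gm \<circ> Fm)"
proof -
  interpret F: cat_functor A B Fo Fm by fact
  interpret G: cat_functor B D Go Gm by fact
  show ?thesis
    by unfold_locales
      (auto intro: F.Fo_Obj G.Fo_Obj F.Fm_Hom G.Fm_Hom
        simp: F.Fm_Ide F.Fo_Obj G.Fm_Ide F.Fm_Comp G.Fm_Comp[OF F.Fm_Hom F.Fm_Hom])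
qed

lemma cat_functor_id:
  assumes "category A"
  shows "cat_functor A A id id"
proof -
  interpret category A by fact
  show ?thesis by unfold_locales auto
qed

lemma (in category) isomorphism_Ide:
  assumes "a \<in> Obj C"
  shows "isomorphism C (Ide C a)"
  using assms Comp_Ide_left[OF Ide_Hom] Ide_Hom unfolding isomorphism_def by blast

text \<open>
  Choose a preimage \<open>So a\<close> of each object \<open>a\<close>, and let \<open>Sm\<close> send an arrow to its unique lift
  between the chosen preimages. Functoriality of \<open>S\<close> and naturality of the counit \<open>\<epsilon>\<close> are equations
  between parallel arrows of \<open>B\<close>, so by faithfulness it is enough that \<open>R\<close> maps both sides to the
  same arrow. As \<open>R \<circ> S\<close> is the identity on the nose, the unit can be taken to be the identity.
\<close>
lemma equivalent_categories_if_fully_faithful_surjective: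
  assumes "cat_functor B A Ro Rm"
    and surj: "\<And>a. a \<in> Obj A \<Longrightarrow> \<exists>x\<in>Obj B. Ro x = a"
    and fully_faithful: "\<And>x y f. \<lbrakk>x \<in> Obj B; y \<in> Obj B; f \<in> Hom A (Ro x) (Ro y)\<rbrakk>
      \<Longrightarrow> \<exists>!g. g \<in> Hom B x y \<and> Rm g = f"
  shows "equivalent_categories A B"
proof -
  interpret R: cat_functor B A Ro Rm by fact
  obtain So where So: "\<And>a. a \<in> Obj A \<Longrightarrow> So a \<in> Obj B" and Ro_So: "\<And>a. a \<in> Obj A \<Longrightarrow> Ro (So a) = a"
    using surj by metis
  define lift where "lift x y f = (THE g. g \<in> Hom B x y \<and> Rm g = f)" for x y f
  have lift: "lift x y f \<in> Hom B x y" "Rm (lift x y f) = f"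
    if "x \<in> Obj B" "y \<in> Obj B" "f \<in> Hom A (Ro x) (Ro y)" for x y f
    using theI'[OF fully_faithful[OF that]] by (auto simp: lift_def)
  have faithful: "g = h" if "g \<in> Hom B x y" "h \<in> Hom B x y" "Rm g = Rm h" for g h x y
  proof -
    have "x \<in> Obj B" "y \<in> Obj B"
      using that(1) R.dom.Dom_Obj R.dom.Cod_Obj by (auto simp: Hom_def)
    from fully_faithful[OF this R.Fm_Hom[OF that(1)]] show ?thesis using that by metis
  qed
  have Hom_Obj: "a \<in> Obj A" "b \<in> Obj A" if "f \<in> Hom A a b" for f a b
    using that R.cod.Dom_Obj R.cod.Cod_Obj by (auto simp: Hom_def)
  have Hom_ObjB: "a \<in> Obj B" "b \<in> Obj B" if "f \<in> Hom B a b" for f a b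
    using that R.dom.Dom_Obj R.dom.Cod_Obj by (auto simp: Hom_def)
  define Sm where "Sm f = lift (So (Dom A f)) (So (Cod A f)) f" for f
  have Sm: "Sm f \<in> Hom B (So a) (So b)" "Rm (Sm f) = f" if "f \<in> Hom A a b" for f a b
    using that lift[of "So a" "So b" f] Hom_Obj[OF that] So Ro_So
    by (auto simp: Sm_def Hom_def)
  have S: "cat_functor A B So Sm"
  proof
    fix a assume a: "a \<in> Obj A"
    show "So a \<in> Obj B" by (rule So[OF a])
    show "Sm (Ide A a) = Ide B (So a)"
      using Sm[OF R.cod.Ide_Hom[OF a]] So[OF a]
      by (intro faithful[OF _ R.dom.Ide_Hom]) (auto simp: R.Fm_Ide Ro_So a)
  next
    fix f g a b c assume f: "f \<in> Hom A a b" and g: "g \<in> Hom A b c"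
    show "Sm (g \<cdot>\<^bsub>A\<^esub> f) = Sm g \<cdot>\<^bsub>B\<^esub> Sm f"
      using Sm[OF f] Sm[OF g] Sm[OF R.cod.Comp_Hom[OF f g]]
      by (intro faithful[OF _ R.dom.Comp_Hom]) (auto simp: R.Fm_Comp)
  qed (rule Sm)
  interpret S: cat_functor A B So Sm by (rule S)
  have "nat_isomorphism A A id id (Ro \<circ> So) (Rm \<circ> Sm) (Ide A)"
    unfolding nat_isomorphism_def nat_isomorphism_axioms_def
    using cat_functor_id[OF R.cod.category_axioms] cat_functor_comp[OF S assms(1)]
    by (auto simp: Ro_So R.cod.Ide_Hom R.cod.isomorphism_Ide Sm(2)
        R.cod.Comp_Ide_left R.cod.Comp_Ide_right)
  moreover
  \<comment> \<open>\<open>So (Ro x)\<close> and \<open>x\<close> have the same image, and the lift of its identity compares them.\<close>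
  define \<epsilon> where "\<epsilon> x = lift (So (Ro x)) x (Ide A (Ro x))" for x
  have \<epsilon>: "\<epsilon> x \<in> Hom B (So (Ro x)) x" "Rm (\<epsilon> x) = Ide A (Ro x)" if "x \<in> Obj B" for x
    using lift[of "So (Ro x)" x "Ide A (Ro x)"] that
    by (auto simp: \<epsilon>_def So R.Fo_Obj Ro_So R.cod.Ide_Hom)
  have "nat_isomorphism B B (So \<circ> Ro) (Sm \<circ> Rm) id id \<epsilon>"
    unfolding nat_isomorphism_def nat_isomorphism_axioms_def
  proof (intro conjI allI impI cat_functor_id cat_functor_comp[OF assms(1) S] R.dom.category_axioms)
    fix x y f assume f: "f \<in> Hom B x y"
    note xy = Hom_ObjB[OF f]
    note SRf = Sm[OF R.Fm_Hom[OF f]]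
    have "\<epsilon> y \<cdot>\<^bsub>B\<^esub> Sm (Rm f) = f \<cdot>\<^bsub>B\<^esub> \<epsilon> x"
      using R.cod.Comp_Ide_left[OF R.Fm_Hom[OF f]] R.cod.Comp_Ide_right[OF R.Fm_Hom[OF f]]
      by (intro faithful[OF R.dom.Comp_Hom[OF SRf(1) \<epsilon>(1)[OF xy(2)]]
            R.dom.Comp_Hom[OF \<epsilon>(1)[OF xy(1)] f]])
        (simp add: R.Fm_Comp[OF SRf(1) \<epsilon>(1)[OF xy(2)]] R.Fm_Comp[OF \<epsilon>(1)[OF xy(1)] f]
          \<epsilon>(2) xy SRf(2))
    then show "\<epsilon> y \<cdot>\<^bsub>B\<^esub> (Sm \<circ> Rm) f = id f \<cdot>\<^bsub>B\<^esub> \<epsilon> x" by simp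
  next
    fix x assume x: "x \<in> Obj B"
    then show "\<epsilon> x \<in> Hom B ((So \<circ> Ro) x) (id x)" using \<epsilon> by simp
    \<comment> \<open>The inverse of \<open>\<epsilon> x\<close> is the lift of the same identity in the other direction.\<close>
    define \<delta> where "\<delta> = lift x (So (Ro x)) (Ide A (Ro x))"
    have \<delta>: "\<delta> \<in> Hom B x (So (Ro x))" "Rm \<delta> = Ide A (Ro x)"
      using lift[of x "So (Ro x)" "Ide A (Ro x)"] x
      by (auto simp: \<delta>_def So R.Fo_Obj Ro_So R.cod.Ide_Hom)
    note SRx = So[OF R.Fo_Obj[OF x]]
    note idem = R.cod.Comp_Ide_left[OF R.cod.Ide_Hom[OF R.Fo_Obj[OF x]]]
    have "\<delta> \<cdot>\<^bsub>B\<^esub> \<epsilon> x = Ide B (So (Ro x))"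
      by (rule faithful[OF R.dom.Comp_Hom[OF \<epsilon>(1)[OF x] \<delta>(1)] R.dom.Ide_Hom[OF SRx]])
        (simp add: R.Fm_Comp[OF \<epsilon>(1)[OF x] \<delta>(1)] \<epsilon>(2) \<delta>(2) x idem R.Fm_Ide SRx Ro_So R.Fo_Obj)
    moreover have "\<epsilon> x \<cdot>\<^bsub>B\<^esub> \<delta> = Ide B x"
      by (rule faithful[OF R.dom.Comp_Hom[OF \<delta>(1) \<epsilon>(1)[OF x]] R.dom.Ide_Hom[OF x]])
        (simp add: R.Fm_Comp[OF \<delta>(1) \<epsilon>(1)[OF x]] \<epsilon>(2) \<delta>(2) x idem R.Fm_Ide)
    ultimately show "isomorphism B (\<epsilon> x)"
      using \<epsilon>(1)[OF x] \<delta>(1) unfolding isomorphism_def by blast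
  qed
  ultimately show ?thesis
    unfolding equivalent_categories_def using S assms(1) by blast
qed


section \<open>Coproducts\<close>

lemma (in category) isomorphism_imp_unique_factor:
  assumes "isomorphism C f" and f: "f \<in> Hom C b c" and k: "k \<in> Hom C a c"
  shows "\<exists>!g. g \<in> Hom C a b \<and> f \<cdot> g = k"
proof -
  obtain f' where f': "f' \<in> Hom C c b" "f' \<cdot> f = Ide C b" "f \<cdot> f' = Ide C c"
    using assms(1) f by (auto simp: isomorphism_def Hom_def)
  show ?thesis
  proof
    show "f' \<cdot> k \<in> Hom C a b \<and> f \<cdot> f' \<cdot> k = k"
      using Comp_Hom[OF k f'(1)] Comp_assoc[OF k f'(1) f] f'(3) Comp_Ide_left[OF k] by simp
    fix g assume "g \<in> Hom C a b \<and> f \<cdot> g = k"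
    then show "g = f' \<cdot> k"
      using Comp_assoc[of g a b f c f' b] f f' Comp_Ide_left by auto
  qed
qed

lemma (in category) is_coproduct_singleton_iff:
  "is_coproduct C {i} X q \<iota> \<longleftrightarrow> \<iota> i \<in> Hom C (X i) q \<and> isomorphism C (\<iota> i)"
proof
  assume cop: "is_coproduct C {i} X q \<iota>"
  then have \<iota>: "\<iota> i \<in> Hom C (X i) q" and X: "X i \<in> Obj C" and q: "q \<in> Obj C"
    by (auto simp: is_coproduct_def)
  have ex: "\<exists>!h. h \<in> Hom C q z \<and> h \<cdot> \<iota> i = g" if "z \<in> Obj C" "g \<in> Hom C (X i) z" for z g
    using cop that unfolding is_coproduct_def by (auto dest!: bspec[of _ _ z] spec[of _ "\<lambda>_. g"])
  obtain h where h: "h \<in> Hom C q (X i)" "h \<cdot> \<iota> i = Ide C (X i)"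
    using ex[OF X Ide_Hom[OF X]] by blast
  \<comment> \<open>Both \<open>\<iota> i \<cdot> h\<close> and the identity factor \<open>\<iota> i\<close> through itself, hence agree.\<close>
  have "\<iota> i \<cdot> h = Ide C q"
    using ex[OF q \<iota>] Comp_Hom[OF h(1) \<iota>] Comp_assoc[OF \<iota> h(1) \<iota>] h(2)
      Comp_Ide_right[OF \<iota>] Comp_Ide_left[OF \<iota>] Ide_Hom[OF q] by metis
  with \<iota> h show "\<iota> i \<in> Hom C (X i) q \<and> isomorphism C (\<iota> i)"
    unfolding isomorphism_def by blast
next
  assume A: "\<iota> i \<in> Hom C (X i) q \<and> isomorphism C (\<iota> i)"
  then obtain h where \<iota>: "\<iota> i \<in> Hom C (X i) q" and h: "h \<in> Hom C q (X i)"
      "h \<cdot> \<iota> i = Ide C (X i)" "\<iota> i \<cdot> h = Ide C q"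
    by (auto simp: isomorphism_def Hom_def)
  have "\<exists>!k. k \<in> Hom C q z \<and> k \<cdot> \<iota> i = g" if g: "g \<in> Hom C (X i) z" for z g
  proof
    show "g \<cdot> h \<in> Hom C q z \<and> (g \<cdot> h) \<cdot> \<iota> i = g"
      using Comp_Hom[OF h(1) g] Comp_assoc[OF \<iota> h(1) g] h(2) Comp_Ide_right[OF g] by simp
    fix k assume "k \<in> Hom C q z \<and> k \<cdot> \<iota> i = g"
    then show "k = g \<cdot> h"
      using Comp_assoc[OF h(1) \<iota>, of k z] h(3) Comp_Ide_right by auto
  qed
  moreover have "X i \<in> Obj C" "q \<in> Obj C"
    using \<iota> Dom_Obj[of "\<iota> i"] Cod_Obj[of "\<iota> i"] by (auto simp: Hom_def)
  ultimately show "is_coproduct C {i} X q \<iota>"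
    using \<iota> by (simp add: is_coproduct_def)
qed

text \<open>
  The edges into an old vertex that is not a source are the \<open>Inl\<close>-images of the edges into it in
  \<open>G\<close>; reindexing along \<open>Inl\<close> makes the two coproduct conditions at this vertex the same.
\<close>
lemma is_coproduct_reindex:
  assumes "inj_on r I"
  shows "is_coproduct C (r ` I) X q \<iota> \<longleftrightarrow> is_coproduct C I (X \<circ> r) q (\<iota> \<circ> r)"
proof -
  have "(\<forall>g. (\<forall>i\<in>r ` I. g i \<in> Hom C (X i) z) \<longrightarrow>
          (\<exists>!h. h \<in> Hom C q z \<and> (\<forall>i\<in>r ` I. h \<cdot>\<^bsub>C\<^esub> \<iota> i = g i))) \<longleftrightarrow>
        (\<forall>g. (\<forall>i\<in>I. g i \<in> Hom C (X (r i)) z) \<longrightarrow>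
          (\<exists>!h. h \<in> Hom C q z \<and> (\<forall>i\<in>I. h \<cdot>\<^bsub>C\<^esub> \<iota> (r i) = g i)))" (is "?L \<longleftrightarrow> ?R") for z
  proof
    assume L: ?L
    \<comment> \<open>A family on \<open>I\<close> is carried to \<open>r ` I\<close> along the inverse of \<open>r\<close>.\<close>
    show ?R
    proof (intro allI impI)
      fix g assume "\<forall>i\<in>I. g i \<in> Hom C (X (r i)) z"
      then show "\<exists>!h. h \<in> Hom C q z \<and> (\<forall>i\<in>I. h \<cdot>\<^bsub>C\<^esub> \<iota> (r i) = g i)"
        using L[THEN spec, of "g \<circ> the_inv_into I r"] by (simp add: the_inv_into_f_f[OF assms])
    qed
  next
    assume R: ?R
    show ?L
    proof
      fix g
      show "(\<forall>i\<in>r ` I. g i \<in> Hom C (X i) z) \<longrightarrow>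
          (\<exists>!h. h \<in> Hom C q z \<and> (\<forall>i\<in>r ` I. h \<cdot>\<^bsub>C\<^esub> \<iota> i = g i))"
        using R[THEN spec, of "g \<circ> r"] by simp
    qed
  qed
  then show ?thesis
    by (simp add: is_coproduct_def)
qed

lemma is_coproduct_cong:
  assumes "\<And>i. i \<in> I \<Longrightarrow> X i = Y i" and "\<And>i. i \<in> I \<Longrightarrow> \<iota> i = \<kappa> i"
  shows "is_coproduct C I X q \<iota> \<longleftrightarrow> is_coproduct C I Y q \<kappa>"
  using assms by (simp add: is_coproduct_def)


section \<open>The graph with heads added\<close>

text \<open>
  The head at \<open>v\<close> as a sequence of vertices starting with \<open>v\<close> itself. Counting \<open>v\<close> as position \<open>0\<close>
  lets the edge \<open>Inr (v, Suc n)\<close> run from position \<open>Suc n\<close> to position \<open>n\<close> for every \<open>n\<close>, without the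
  exception at the end of the head, and so permits induction on \<open>n\<close>.
\<close>
definition head_vert :: "'v \<Rightarrow> nat \<Rightarrow> 'v + 'v \<times> nat" where
  "head_vert v n = (if n = 0 then Inl v else Inr (v, n))"

lemma head_vert_0 [simp]: "head_vert v 0 = Inl v"
  by (simp add: head_vert_def)

lemma add_heads_simps [simp]:
  "tail (add_heads G) (Inl e) = Inl (tail G e)"
  "head (add_heads G) (Inl e) = Inl (head G e)"
  "tail (add_heads G) (Inr (v, Suc n)) = head_vert v (Suc n)"
  "head (add_heads G) (Inr (v, Suc n)) = head_vert v n"
  "Inl v \<in> verts (add_heads G) \<longleftrightarrow> v \<in> verts G"
  "Inl e \<in> arcs (add_heads G) \<longleftrightarrow> e \<in> arcs G"
  "Inr (v, n) \<in> arcs (add_heads G) \<longleftrightarrow> v \<in> source_verts G \<and> n \<ge> 1"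
  by (auto simp: add_heads_def head_vert_def)

lemma source_verts_in_verts: "v \<in> source_verts G \<Longrightarrow> v \<in> verts G"
  by (simp add: source_verts_def)

lemma head_vert_in_verts: "v \<in> source_verts G \<Longrightarrow> head_vert v n \<in> verts (add_heads G)"
  by (auto simp: add_heads_def head_vert_def source_verts_def)

lemma arcs_add_heads_cases [consumes 1, case_names old new]:
  assumes "x \<in> arcs (add_heads G)"
  obtains e where "e \<in> arcs G" "x = Inl e"
  | v n where "v \<in> source_verts G" "x = Inr (v, Suc n)"
proof -
  have "n \<ge> 1 \<Longrightarrow> \<exists>m. n = Suc m" for n :: nat by presburger
  then show thesis using assms that by (fastforce simp: add_heads_def)
qed

lemma verts_add_heads_cases [consumes 1, case_names old new]:
  assumes "x \<in> verts (add_heads G)"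
  obtains v where "v \<in> verts G" "x = Inl v"
  | v n where "v \<in> source_verts G" "x = head_vert v n"
proof -
  consider v where "v \<in> verts G" "x = Inl v"
    | v n where "v \<in> source_verts G" "n \<ge> 1" "x = Inr (v, n)"
    using assms by (auto simp: add_heads_def)
  then show thesis
  proof cases
    case (2 v n)
    then show thesis using that(2)[of v n] by (simp add: head_vert_def)
  qed (rule that(1))
qed

lemma in_arcs_add_heads_Inl:
  assumes "v \<in> verts G - source_verts G"
  shows "in_arcs (add_heads G) (Inl v) = Inl ` in_arcs G v"
  using assms by (auto simp: in_arcs_def head_vert_def elim!: arcs_add_heads_cases split: if_splits)

lemma in_arcs_add_heads_head_vert:
  assumes "v \<in> source_verts G"
  shows "in_arcs (add_heads G) (head_vert v n) = {Inr (v, Suc n)}"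
  using assms
  by (auto simp: in_arcs_def head_vert_def source_verts_def elim!: arcs_add_heads_cases split: if_splits)

text \<open>
  Each source has received an incoming edge, and so has each new vertex. Hence a diagram on the
  larger graph has to satisfy the coproduct condition at every vertex.
\<close>
lemma source_verts_add_heads: "source_verts (add_heads G) = {}"
proof -
  have "in_arcs (add_heads G) x \<noteq> {}" if "x \<in> verts (add_heads G)" for x
    using that
  proof (cases rule: verts_add_heads_cases)
    case (old v)
    then show ?thesis
      using in_arcs_add_heads_Inl[of v G] in_arcs_add_heads_head_vert[of v G 0]
      by (cases "v \<in> source_verts G") (auto simp: source_verts_def)
  qed (simp add: in_arcs_add_heads_head_vert)
  then show ?thesis by (auto simp: source_verts_def)
qed


section \<open>Restriction and extension of diagrams\<close>

definition restrict_diagram ::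
    "('v, 'e) pre_digraph \<Rightarrow> ('v + 'v \<times> nat, 'e + 'v \<times> nat, 'o, 'm) diagram \<Rightarrow>
     ('v, 'e, 'o, 'm) diagram" where
  "restrict_diagram G D = \<lparr>
     vert_obj = (\<lambda>v\<in>verts G. vert_obj D (Inl v)),
     arc_mor = (\<lambda>e\<in>arcs G. arc_mor D (Inl e))\<rparr>"

definition restrict_arrow ::
    "('v, 'e) pre_digraph \<Rightarrow> ('v + 'v \<times> nat, 'e + 'v \<times> nat, 'o, 'm) diagram_arrow \<Rightarrow>
     ('v, 'e, 'o, 'm) diagram_arrow" where
  "restrict_arrow G t = \<lparr>
     arrow_dom = restrict_diagram G (arrow_dom t),
     arrow_cod = restrict_diagram G (arrow_cod t),
     component = (\<lambda>v\<in>verts G. component t (Inl v))\<rparr>"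

definition extend_diagram ::
    "('o, 'm) pre_category \<Rightarrow> ('v, 'e) pre_digraph \<Rightarrow> ('v, 'e, 'o, 'm) diagram \<Rightarrow>
     ('v + 'v \<times> nat, 'e + 'v \<times> nat, 'o, 'm) diagram" where
  "extend_diagram C G D = \<lparr>
     vert_obj = (\<lambda>x\<in>verts (add_heads G). case x of Inl v \<Rightarrow> vert_obj D v | Inr (v, n) \<Rightarrow> vert_obj D v),
     arc_mor = (\<lambda>x\<in>arcs (add_heads G). case x of
       Inl e \<Rightarrow> arc_mor D e | Inr (v, n) \<Rightarrow> Ide C (vert_obj D v))\<rparr>"

locale graph_in_category = category C + wf_digraph G
  for C :: "('o, 'm) pre_category" (structure) and G :: "('v, 'e) pre_digraph"
begin

lemma Obj_Diag: "Obj (Diag C H) = {D. is_diagram C H D \<and> coproduct_condition C H D}"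
  by (simp add: Diag_def)

lemma is_diagram_restrict_diagram:
  assumes "is_diagram C (add_heads G) D"
  shows "is_diagram C G (restrict_diagram G D)"
proof -
  have "arc_mor D (Inl e) \<in> Hom C (vert_obj D (Inl (tail G e))) (vert_obj D (Inl (head G e)))"
    if "e \<in> arcs G" for e
    using assms that unfolding is_diagram_def by (force dest: PiE_mem[where x = "Inl e"])
  moreover have "vert_obj D (Inl v) \<in> Obj C" if "v \<in> verts G" for v
    using assms that unfolding is_diagram_def by (force dest: PiE_mem[where x = "Inl v"])
  ultimately show ?thesis
    by (auto simp: is_diagram_def restrict_diagram_def)
qed

lemma is_diagram_head_arc:
  assumes "is_diagram C (add_heads G) D" and "v \<in> source_verts G"
  shows "arc_mor D (Inr (v, Suc n)) \<in> Hom C (vert_obj D (head_vert v (Suc n))) (vert_obj D (head_vert v n))"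
  using assms unfolding is_diagram_def by (force dest: PiE_mem[where x = "Inr (v, Suc n)"])

text \<open>
  The conditions split by the kind of vertex: old vertices that are not sources see the same
  incoming edges as in \<open>G\<close>, while a vertex on a head, the source at its end included, sees a single
  edge, whose morphism must then be an isomorphism.
\<close>
lemma coproduct_condition_add_heads_iff:
  assumes "is_diagram C (add_heads G) D"
  shows "coproduct_condition C (add_heads G) D \<longleftrightarrow>
    coproduct_condition C G (restrict_diagram G D) \<and>
    (\<forall>v\<in>source_verts G. \<forall>n. isomorphism C (arc_mor D (Inr (v, Suc n))))"
proof -
  let ?P = "\<lambda>x. is_coproduct C (in_arcs (add_heads G) x)
    (\<lambda>e. vert_obj D (tail (add_heads G) e)) (vert_obj D x) (arc_mor D)"
  have old: "?P (Inl v) \<longleftrightarrow> is_coproduct C (in_arcs G v)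
      (\<lambda>e. vert_obj (restrict_diagram G D) (tail G e)) (vert_obj (restrict_diagram G D) v)
      (arc_mor (restrict_diagram G D))" if v: "v \<in> verts G - source_verts G" for v
  proof -
    have "vert_obj (restrict_diagram G D) v = vert_obj D (Inl v)"
      using v by (simp add: restrict_diagram_def)
    then show ?thesis
      unfolding in_arcs_add_heads_Inl[OF v] is_coproduct_reindex[OF inj_Inl]
      by (simp, intro is_coproduct_cong) (auto simp: restrict_diagram_def in_arcs_def)
  qed
  have new: "?P (head_vert v n) \<longleftrightarrow> isomorphism C (arc_mor D (Inr (v, Suc n)))"
    if v: "v \<in> source_verts G" for v n
    using is_diagram_head_arc[OF assms v, of n]
    by (simp add: in_arcs_add_heads_head_vert[OF v] is_coproduct_singleton_iff)
  have "(\<forall>x\<in>verts (add_heads G). ?P x) \<longleftrightarrow>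
      (\<forall>v\<in>verts G - source_verts G. ?P (Inl v)) \<and> (\<forall>v\<in>source_verts G. \<forall>n. ?P (head_vert v n))"
    by (metis (no_types, lifting) DiffD1 DiffI add_heads_simps(5) head_vert_0 head_vert_in_verts
        verts_add_heads_cases)
  with old new show ?thesis
    by (simp add: coproduct_condition_def source_verts_add_heads)
qed

lemma restrict_diagram_in_Obj:
  "D \<in> Obj (Diag C (add_heads G)) \<Longrightarrow> restrict_diagram G D \<in> Obj (Diag C G)"
  by (auto simp: Obj_Diag coproduct_condition_add_heads_iff is_diagram_restrict_diagram)

lemma restrict_extend_diagram:
  assumes "is_diagram C G D"
  shows "restrict_diagram G (extend_diagram C G D) = D"
proof -
  have "(\<lambda>v\<in>verts G. vert_obj D v) = vert_obj D" "(\<lambda>e\<in>arcs G. arc_mor D e) = arc_mor D"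
    using assms by (auto simp: is_diagram_def PiE_iff extensional_restrict)
  then show ?thesis
    by (simp add: restrict_diagram_def extend_diagram_def cong: restrict_cong)
qed

lemma is_diagram_extend_diagram:
  assumes "is_diagram C G D"
  shows "is_diagram C (add_heads G) (extend_diagram C G D)"
proof -
  have V: "vert_obj D v \<in> Obj C" if "v \<in> verts G" for v
    using assms that by (auto simp: is_diagram_def)
  have A: "arc_mor D e \<in> Hom C (vert_obj D (tail G e)) (vert_obj D (head G e))" if "e \<in> arcs G" for e
    using assms that by (auto simp: is_diagram_def)
  have hv: "vert_obj (extend_diagram C G D) (head_vert v n) = vert_obj D v"
    if "v \<in> source_verts G" for v n
    using head_vert_in_verts[OF that, of n] by (simp add: extend_diagram_def head_vert_def split: if_splits)
  have ol: "vert_obj (extend_diagram C G D) (Inl v) = vert_obj D v" if "v \<in> verts G" for v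
    using that by (simp add: extend_diagram_def)
  have "vert_obj (extend_diagram C G D) x \<in> Obj C" if "x \<in> verts (add_heads G)" for x
    using that by (cases rule: verts_add_heads_cases) (auto simp: hv ol V source_verts_in_verts)
  moreover have "arc_mor (extend_diagram C G D) x \<in>
      Hom C (vert_obj (extend_diagram C G D) (tail (add_heads G) x))
        (vert_obj (extend_diagram C G D) (head (add_heads G) x))" if "x \<in> arcs (add_heads G)" for x
    using that
    by (cases rule: arcs_add_heads_cases)
      (simp_all add: hv ol A V Ide_Hom source_verts_in_verts, simp_all add: extend_diagram_def A V Ide_Hom source_verts_in_verts)
  ultimately show ?thesis
    unfolding is_diagram_def by (auto simp: PiE_iff, auto simp: extend_diagram_def)
qed

lemma extend_diagram_in_Obj:
  assumes "D \<in> Obj (Diag C G)"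
  shows "extend_diagram C G D \<in> Obj (Diag C (add_heads G))"
proof -
  have D: "is_diagram C G D" "coproduct_condition C G D"
    using assms by (auto simp: Obj_Diag)
  then have "isomorphism C (arc_mor (extend_diagram C G D) (Inr (v, Suc n)))"
    if "v \<in> source_verts G" for v n
    using that isomorphism_Ide[of "vert_obj D v"]
    by (auto simp: extend_diagram_def source_verts_def is_diagram_def)
  with D show ?thesis
    by (simp add: Obj_Diag coproduct_condition_add_heads_iff is_diagram_extend_diagram
        restrict_extend_diagram)
qed

text \<open>
  Naturality at the edges of a head appears here as a recursion for the components along the head:
  the component at position \<open>Suc n\<close> is constrained by the one at position \<open>n\<close>.
\<close>
lemma is_diagram_mor_add_heads_iff:
  assumes "is_diagram C (add_heads G) D" and "is_diagram C (add_heads G) E"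
  shows "is_diagram_mor C (add_heads G) D E T \<longleftrightarrow>
    T \<in> extensional (verts (add_heads G)) \<and>
    is_diagram_mor C G (restrict_diagram G D) (restrict_diagram G E) (\<lambda>v\<in>verts G. T (Inl v)) \<and>
    (\<forall>v\<in>source_verts G. \<forall>n.
      T (head_vert v (Suc n)) \<in> Hom C (vert_obj D (head_vert v (Suc n))) (vert_obj E (head_vert v (Suc n))) \<and>
      arc_mor E (Inr (v, Suc n)) \<cdot> T (head_vert v (Suc n)) = T (head_vert v n) \<cdot> arc_mor D (Inr (v, Suc n)))"
    (is "?L \<longleftrightarrow> ?R")
proof
  assume ?L
  then have T: "T \<in> extensional (verts (add_heads G))"
      "\<And>x. x \<in> verts (add_heads G) \<Longrightarrow> T x \<in> Hom C (vert_obj D x) (vert_obj E x)"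
    and N: "\<And>x. x \<in> arcs (add_heads G) \<Longrightarrow>
      T (head (add_heads G) x) \<cdot> arc_mor D x = arc_mor E x \<cdot> T (tail (add_heads G) x)"
    by (auto simp: is_diagram_mor_def PiE_iff)
  have "is_diagram_mor C G (restrict_diagram G D) (restrict_diagram G E) (\<lambda>v\<in>verts G. T (Inl v))"
    using T(2)[of "Inl v" for v] N[of "Inl e" for e]
    by (auto simp: is_diagram_mor_def restrict_diagram_def)
  then show ?R
    using T N[of "Inr (v, Suc n)" for v n] by (auto simp: head_vert_in_verts)
next
  assume R: ?R
  have old: "T (Inl v) \<in> Hom C (vert_obj D (Inl v)) (vert_obj E (Inl v))" if "v \<in> verts G" for v
    using R that by (auto simp: is_diagram_mor_def restrict_diagram_def PiE_iff)
  have "T (head_vert v n) \<in> Hom C (vert_obj D (head_vert v n)) (vert_obj E (head_vert v n))"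
    if "v \<in> source_verts G" for v n
    using R old that by (cases n) (auto simp: source_verts_in_verts)
  then have vert: "T x \<in> Hom C (vert_obj D x) (vert_obj E x)" if "x \<in> verts (add_heads G)" for x
    using verts_add_heads_cases[OF that] old by metis
  have arc: "T (Inl (head G e)) \<cdot> arc_mor D (Inl e) = arc_mor E (Inl e) \<cdot> T (Inl (tail G e))"
    if "e \<in> arcs G" for e
    using R that by (auto simp: is_diagram_mor_def restrict_diagram_def)
  have "T (head (add_heads G) x) \<cdot> arc_mor D x = arc_mor E x \<cdot> T (tail (add_heads G) x)"
    if "x \<in> arcs (add_heads G)" for x
    by (rule arcs_add_heads_cases[OF that]) (use R arc in auto)
  with vert show ?L
    using R by (auto simp: is_diagram_mor_def PiE_iff)
qed

text \<open>
  Since \<open>E\<close> has isomorphisms along the heads, that recursion has exactly one solution with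
  value \<open>T v\<close> at position \<open>0\<close>. This holds for each source \<open>v\<close> separately, as heads at different
  sources share no vertices.
\<close>
lemma ex1_extension_of_diagram_mor:
  assumes "D \<in> Obj (Diag C (add_heads G))" and "E \<in> Obj (Diag C (add_heads G))"
    and T: "is_diagram_mor C G (restrict_diagram G D) (restrict_diagram G E) T"
  shows "\<exists>!S. is_diagram_mor C (add_heads G) D E S \<and> (\<lambda>v\<in>verts G. S (Inl v)) = T"
proof -
  have D: "is_diagram C (add_heads G) D" and E: "is_diagram C (add_heads G) E"
    and iso: "\<And>v n. v \<in> source_verts G \<Longrightarrow> isomorphism C (arc_mor E (Inr (v, Suc n)))"
    using assms(1,2) by (auto simp: Obj_Diag coproduct_condition_add_heads_iff)
  let ?H = "\<lambda>v n. Hom C (vert_obj D (head_vert v n)) (vert_obj E (head_vert v n))"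
  let ?N = "\<lambda>v n s s'. arc_mor E (Inr (v, Suc n)) \<cdot> s' = s \<cdot> arc_mor D (Inr (v, Suc n))"
  have T_old: "T v \<in> ?H v 0" if "v \<in> verts G" for v
    using T that by (auto simp: is_diagram_mor_def restrict_diagram_def PiE_iff)
  have step: "\<exists>!s'. s' \<in> ?H v (Suc n) \<and> ?N v n s s'" if "v \<in> source_verts G" "s \<in> ?H v n" for v n s
    using isomorphism_imp_unique_factor[OF iso[OF that(1)] is_diagram_head_arc[OF E that(1)]
        Comp_Hom[OF is_diagram_head_arc[OF D that(1)] that(2)]] .
  have "\<exists>s. \<forall>n. (s n \<in> ?H v n \<and> (n = 0 \<longrightarrow> s n = T v)) \<and> ?N v n (s n) (s (Suc n))"
    if v: "v \<in> source_verts G" for v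
  proof (rule dependent_nat_choice)
    show "\<exists>s. s \<in> ?H v 0 \<and> (0 = (0::nat) \<longrightarrow> s = T v)"
      using T_old[OF source_verts_in_verts[OF v]] by blast
  next
    fix s n assume "s \<in> ?H v n \<and> (n = 0 \<longrightarrow> s = T v)"
    then show "\<exists>s'. (s' \<in> ?H v (Suc n) \<and> (Suc n = 0 \<longrightarrow> s' = T v)) \<and> ?N v n s s'"
      using step[OF v, of s n] by auto
  qed
  then obtain s where s: "\<And>v n. v \<in> source_verts G \<Longrightarrow> s v n \<in> ?H v n"
    "\<And>v. v \<in> source_verts G \<Longrightarrow> s v 0 = T v"
    "\<And>v n. v \<in> source_verts G \<Longrightarrow> ?N v n (s v n) (s v (Suc n))"
    by metis
  define S where "S = (\<lambda>x\<in>verts (add_heads G). case x of Inl v \<Rightarrow> T v | Inr (v, n) \<Rightarrow> s v n)"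
  have S_head: "S (head_vert v n) = s v n" if "v \<in> source_verts G" for v n
    using head_vert_in_verts[OF that, of n] s(2)[OF that]
    by (auto simp: S_def head_vert_def split: if_splits)
  have S_old: "(\<lambda>v\<in>verts G. S (Inl v)) = T"
    using T by (auto simp: S_def is_diagram_mor_def PiE_iff extensional_restrict cong: restrict_cong)
  show ?thesis
  proof
    show "is_diagram_mor C (add_heads G) D E S \<and> (\<lambda>v\<in>verts G. S (Inl v)) = T"
      unfolding is_diagram_mor_add_heads_iff[OF D E] S_old
      using s T by (simp add: S_head) (simp add: S_def)
  next
    fix S' assume S': "is_diagram_mor C (add_heads G) D E S' \<and> (\<lambda>v\<in>verts G. S' (Inl v)) = T"
    then have ext: "S' \<in> extensional (verts (add_heads G))"
      and head: "\<And>v n. v \<in> source_verts G \<Longrightarrow>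
        S' (head_vert v (Suc n)) \<in> ?H v (Suc n) \<and> ?N v n (S' (head_vert v n)) (S' (head_vert v (Suc n)))"
      unfolding is_diagram_mor_add_heads_iff[OF D E] by blast+
    have old: "S' (Inl v) = T v" "S (Inl v) = T v" if "v \<in> verts G" for v
      using S' S_old that by (metis restrict_apply')+
    have "S' (head_vert v n) = s v n" if v: "v \<in> source_verts G" for v n
    proof (induction n)
      case 0
      then show ?case using old(1)[OF source_verts_in_verts[OF v]] s(2)[OF v] by simp
    next
      case (Suc n)
      then show ?case
        using step[OF v s(1)[OF v, of n]] head[OF v, of n] s(1)[OF v, of "Suc n"] s(3)[OF v, of n] by metis
    qed
    then have "S' x = S x" if "x \<in> verts (add_heads G)" for x
      using verts_add_heads_cases[OF that] old S_head by metis
    then show "S' = S"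
      by (intro extensionalityI[OF ext]) (auto simp: S_def)
  qed
qed

lemma Hom_Diag:
  "t \<in> Hom (Diag C H) D E \<longleftrightarrow>
     D \<in> Obj (Diag C H) \<and> E \<in> Obj (Diag C H) \<and> arrow_dom t = D \<and> arrow_cod t = E \<and>
     is_diagram_mor C H D E (component t)"
  by (auto simp: Diag_def Hom_def)

lemma cat_functor_restrict:
  "cat_functor (Diag C (add_heads G)) (Diag C G) (restrict_diagram G) (restrict_arrow G)"
proof -
  interpret A: category "Diag C (add_heads G)"
    by (intro category_Diag wf_digraph_add_heads wf_digraph_axioms category_axioms)
  interpret B: category "Diag C G"
    by (intro category_Diag wf_digraph_axioms category_axioms)
  show ?thesis
  proof
    fix D E t assume "t \<in> Hom (Diag C (add_heads G)) D E"
    then show "restrict_arrow G t \<in> Hom (Diag C G) (restrict_diagram G D) (restrict_diagram G E)"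
      using is_diagram_mor_add_heads_iff[of D E "component t"]
      by (auto simp: Hom_Diag restrict_arrow_def restrict_diagram_in_Obj) (auto simp: Obj_Diag)
  next
    fix D assume "D \<in> Obj (Diag C (add_heads G))"
    then show "restrict_arrow G (Ide (Diag C (add_heads G)) D) = Ide (Diag C G) (restrict_diagram G D)"
      by (auto simp: Diag_def restrict_arrow_def restrict_diagram_def)
  next
    fix D E F s t
    assume "t \<in> Hom (Diag C (add_heads G)) D E" "s \<in> Hom (Diag C (add_heads G)) E F"
    show "restrict_arrow G (s \<cdot>\<^bsub>Diag C (add_heads G)\<^esub> t) =
        restrict_arrow G s \<cdot>\<^bsub>Diag C G\<^esub> restrict_arrow G t"
      by (auto simp: Diag_def restrict_arrow_def)
  qed (rule restrict_diagram_in_Obj)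
qed

text \<open>
  An arrow consists of its two diagrams and its components, and the diagrams are prescribed here;
  what remains is the unique extension of the components.
\<close>
lemma restrict_fully_faithful:
  assumes D: "D \<in> Obj (Diag C (add_heads G))" and E: "E \<in> Obj (Diag C (add_heads G))"
    and t: "t \<in> Hom (Diag C G) (restrict_diagram G D) (restrict_diagram G E)"
  shows "\<exists>!s. s \<in> Hom (Diag C (add_heads G)) D E \<and> restrict_arrow G s = t"
proof -
  have "is_diagram_mor C G (restrict_diagram G D) (restrict_diagram G E) (component t)"
    using t by (simp add: Hom_Diag)
  from ex1_extension_of_diagram_mor[OF D E this] obtain S where
    S: "is_diagram_mor C (add_heads G) D E S" "(\<lambda>v\<in>verts G. S (Inl v)) = component t"
    and uniq: "\<And>S'. is_diagram_mor C (add_heads G) D E S' \<Longrightarrow>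
      (\<lambda>v\<in>verts G. S' (Inl v)) = component t \<Longrightarrow> S' = S"
    by blast
  show ?thesis
  proof
    show "\<lparr>arrow_dom = D, arrow_cod = E, component = S\<rparr> \<in> Hom (Diag C (add_heads G)) D E \<and>
        restrict_arrow G \<lparr>arrow_dom = D, arrow_cod = E, component = S\<rparr> = t"
      using S t D E by (auto simp: Hom_Diag restrict_arrow_def)
    fix s assume "s \<in> Hom (Diag C (add_heads G)) D E \<and> restrict_arrow G s = t"
    then show "s = \<lparr>arrow_dom = D, arrow_cod = E, component = S\<rparr>"
      using uniq[of "component s"] by (auto simp: Hom_Diag restrict_arrow_def)
  qed
qed

end

theorem theorem4p16:
  fixes G :: "('v, 'e) pre_digraph" and C :: "('o, 'm) pre_category"
  assumes "wf_digraph G" and "verts G \<noteq> {}" and "category C"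
  shows "equivalent_categories (Diag C G) (Diag C (add_heads G))"
proof -
  interpret category C by fact
  interpret wf_digraph G by fact
  interpret graph_in_category C G ..
  show ?thesis
  proof (rule equivalent_categories_if_fully_faithful_surjective[OF cat_functor_restrict])
    fix D assume D: "D \<in> Obj (Diag C G)"
    then have "restrict_diagram G (extend_diagram C G D) = D"
      by (intro restrict_extend_diagram) (simp add: Obj_Diag)
    then show "\<exists>D'\<in>Obj (Diag C (add_heads G)). restrict_diagram G D' = D"
      using extend_diagram_in_Obj[OF D] by blast
  qed (rule restrict_fully_faithful)
qed

end
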